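(* Let $R$ be a commutative ring with identity and $S$ a multiplicative subset of $R$. If $R$ is a $u$-$S$-von Neumann regular ring, then the localization $R_S$ is a von Neumann regular ring. Consequently, any $u$-$S$-von Neumann regular ring is $c$-$S$-coherent.
   Context: A multiplicative subset $S$ of $R$ is a subset with $1\in S$ and $s_1s_2\in S$ for all $s_1,s_2\in S$. $R$ is $u$-$S$-von Neumann regular if there exists $s\in S$ such that for any $a\in R$ there exists $r\in R$ with $sa=ra^2$. A ring is von Neumann regular if for any element $a$ there is an element $r$ with $a=ra^2$. An ideal $I$ is $S$-finite if there exist $s\in S$ and a finitely generated ideal $J\subseteq I$ with $sI\subseteq J$. The ring $R$ is $c$-$S$-coherent if every $S$-finite ideal $I$ of $R$ is $c$-$S$-finitely presented, that is, there exist $s\in S$ and a sub-ideal $J$ of $I$, finitely presented as an $R$-module, such that $sI\subseteq J\subseteq I$. *)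

theory Defs
  imports "HOL-Algebra.Ideal" "HOL-Algebra.Module"
begin

text \<open>
  A multiplicative subset of a ring \<open>R\<close> is a \<^locale>\<open>submonoid\<close> of its multiplicative monoid;
  it may contain zero, in which case the localization is the zero ring.
\<close>

section \<open>Localization\<close>

definition loc_rel :: "('a, 'b) ring_scheme \<Rightarrow> 'a set \<Rightarrow> (('a \<times> 'a) \<times> ('a \<times> 'a)) set"
  where "loc_rel R S = {((a, s), (b, t)).
    a \<in> carrier R \<and> s \<in> S \<and> b \<in> carrier R \<and> t \<in> S \<and>
    (\<exists>u\<in>S. u \<otimes>\<^bsub>R\<^esub> (t \<otimes>\<^bsub>R\<^esub> a \<ominus>\<^bsub>R\<^esub> s \<otimes>\<^bsub>R\<^esub> b) = \<zero>\<^bsub>R\<^esub>)}"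

definition loc_frac :: "('a, 'b) ring_scheme \<Rightarrow> 'a set \<Rightarrow> 'a \<Rightarrow> 'a \<Rightarrow> ('a \<times> 'a) set"
  where "loc_frac R S a s = loc_rel R S `` {(a, s)}"

text \<open>
  The operations take unions over all representatives; these are unions of a single class, see
  \<open>localization_add\<close> and \<open>localization_mult\<close> below.
\<close>

definition localization :: "('a, 'b) ring_scheme \<Rightarrow> 'a set \<Rightarrow> ('a \<times> 'a) set ring"
  where "localization R S =
    \<lparr>carrier = (carrier R \<times> S) // loc_rel R S,
     mult = (\<lambda>P Q. \<Union>(a, s)\<in>P. \<Union>(b, t)\<in>Q. loc_frac R S (a \<otimes>\<^bsub>R\<^esub> b) (s \<otimes>\<^bsub>R\<^esub> t)),
     one = loc_frac R S \<one>\<^bsub>R\<^esub> \<one>\<^bsub>R\<^esub>,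
     zero = loc_frac R S \<zero>\<^bsub>R\<^esub> \<one>\<^bsub>R\<^esub>,
     add = (\<lambda>P Q. \<Union>(a, s)\<in>P. \<Union>(b, t)\<in>Q.
       loc_frac R S (t \<otimes>\<^bsub>R\<^esub> a \<oplus>\<^bsub>R\<^esub> s \<otimes>\<^bsub>R\<^esub> b) (s \<otimes>\<^bsub>R\<^esub> t))\<rparr>"

section \<open>Von Neumann regularity\<close>

locale von_neumann_regular = cring +
  assumes regular: "a \<in> carrier R \<Longrightarrow> \<exists>r\<in>carrier R. a = r \<otimes> a [^] (2::nat)"

definition u_S_von_neumann_regular :: "('a, 'b) ring_scheme \<Rightarrow> 'a set \<Rightarrow> bool"
  where "u_S_von_neumann_regular R S \<longleftrightarrow>
    (\<exists>s\<in>S. \<forall>a\<in>carrier R. \<exists>r\<in>carrier R. s \<otimes>\<^bsub>R\<^esub> a = r \<otimes>\<^bsub>R\<^esub> a [^]\<^bsub>R\<^esub> (2::nat))"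

section \<open>Finitely presented modules\<close>

definition module_hom ::
    "('a, 'r) ring_scheme \<Rightarrow> ('a, 'b, 'm) module_scheme \<Rightarrow> ('a, 'c, 'n) module_scheme \<Rightarrow> ('b \<Rightarrow> 'c) set"
  where "module_hom R M N = {f \<in> hom (add_monoid M) (add_monoid N).
    \<forall>r\<in>carrier R. \<forall>x\<in>carrier M. f (r \<odot>\<^bsub>M\<^esub> x) = r \<odot>\<^bsub>N\<^esub> f x}"

definition gen_submodule :: "('a, 'r) ring_scheme \<Rightarrow> ('a, 'b, 'm) module_scheme \<Rightarrow> 'b set \<Rightarrow> 'b set"
  where "gen_submodule R M A = \<Inter>{N. submodule N R M \<and> A \<subseteq> N}"

definition fin_gen_submodule :: "('a, 'r) ring_scheme \<Rightarrow> ('a, 'b, 'm) module_scheme \<Rightarrow> 'b set \<Rightarrow> bool"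
  where "fin_gen_submodule R M N \<longleftrightarrow>
    (\<exists>A. finite A \<and> A \<subseteq> carrier M \<and> N = gen_submodule R M A)"

text \<open>
  The record type of modules extends that of rings, so the two modules below have to supply
  values for \<^const>\<open>mult\<close> and \<^const>\<open>one\<close>; the module structure does not involve them.
\<close>

definition free_module :: "('a, 'r) ring_scheme \<Rightarrow> nat \<Rightarrow> ('a, nat \<Rightarrow> 'a) module"
  where "free_module R n =
    \<lparr>carrier = {..<n} \<rightarrow>\<^sub>E carrier R,
     mult = (\<lambda>x y. \<lambda>i\<in>{..<n}. x i \<otimes>\<^bsub>R\<^esub> y i),
     one = (\<lambda>i\<in>{..<n}. \<one>\<^bsub>R\<^esub>),
     zero = (\<lambda>i\<in>{..<n}. \<zero>\<^bsub>R\<^esub>),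
     add = (\<lambda>x y. \<lambda>i\<in>{..<n}. x i \<oplus>\<^bsub>R\<^esub> y i),
     smult = (\<lambda>r x. \<lambda>i\<in>{..<n}. r \<otimes>\<^bsub>R\<^esub> x i)\<rparr>"

definition ideal_module :: "('a, 'r) ring_scheme \<Rightarrow> 'a set \<Rightarrow> ('a, 'a) module"
  where "ideal_module R J =
    \<lparr>carrier = J, mult = mult R, one = \<one>\<^bsub>R\<^esub>, zero = \<zero>\<^bsub>R\<^esub>, add = add R, smult = mult R\<rparr>"

text \<open>
  Finite presentation: an exact sequence \<open>R\<^sup>m \<rightarrow> R\<^sup>n \<rightarrow> M \<rightarrow> 0\<close>, that is, a surjection from some
  \<open>R\<^sup>n\<close> with finitely generated kernel.
\<close>

definition fin_presented :: "('a, 'r) ring_scheme \<Rightarrow> ('a, 'b, 'm) module_scheme \<Rightarrow> bool"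
  where "fin_presented R M \<longleftrightarrow> module R M \<and>
    (\<exists>n. \<exists>f\<in>module_hom R (free_module R n) M.
      f ` carrier (free_module R n) = carrier M \<and>
      fin_gen_submodule R (free_module R n) (a_kernel (free_module R n) M f))"

section \<open>\<open>c\<close>-\<open>S\<close>-coherence\<close>

definition fin_gen_ideal :: "('a, 'b) ring_scheme \<Rightarrow> 'a set \<Rightarrow> bool"
  where "fin_gen_ideal R J \<longleftrightarrow> (\<exists>A. finite A \<and> A \<subseteq> carrier R \<and> J = Idl\<^bsub>R\<^esub> A)"

definition S_finite :: "('a, 'b) ring_scheme \<Rightarrow> 'a set \<Rightarrow> 'a set \<Rightarrow> bool"
  where "S_finite R S I \<longleftrightarrow>
    (\<exists>s\<in>S. \<exists>J. fin_gen_ideal R J \<and> J \<subseteq> I \<and> s <#\<^bsub>R\<^esub> I \<subseteq> J)"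

definition c_S_fin_presented :: "('a, 'b) ring_scheme \<Rightarrow> 'a set \<Rightarrow> 'a set \<Rightarrow> bool"
  where "c_S_fin_presented R S I \<longleftrightarrow>
    (\<exists>s\<in>S. \<exists>J. ideal J R \<and> fin_presented R (ideal_module R J) \<and> s <#\<^bsub>R\<^esub> I \<subseteq> J \<and> J \<subseteq> I)"

definition c_S_coherent :: "('a, 'b) ring_scheme \<Rightarrow> 'a set \<Rightarrow> bool"
  where "c_S_coherent R S \<longleftrightarrow>
    (\<forall>I. ideal I R \<longrightarrow> S_finite R S I \<longrightarrow> c_S_fin_presented R S I)"

section \<open>Well-definedness of the constructions\<close>

lemma (in cring) loc_rel_iff:
  assumes "submonoid S R"
  shows "((a, s), (b, t)) \<in> loc_rel R S \<longleftrightarrow>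
    a \<in> carrier R \<and> s \<in> S \<and> b \<in> carrier R \<and> t \<in> S \<and>
    (\<exists>u\<in>S. u \<otimes> (t \<otimes> a) = u \<otimes> (s \<otimes> b))"
proof -
  interpret S: submonoid S R by fact
  have "u \<otimes> (t \<otimes> a \<ominus> s \<otimes> b) = \<zero> \<longleftrightarrow> u \<otimes> (t \<otimes> a) = u \<otimes> (s \<otimes> b)"
    if "a \<in> carrier R" "b \<in> carrier R" "s \<in> S" "t \<in> S" "u \<in> S" for u
  proof -
    have "u \<otimes> (t \<otimes> a \<ominus> s \<otimes> b) = u \<otimes> (t \<otimes> a) \<ominus> u \<otimes> (s \<otimes> b)"
      using that by (simp add: a_minus_def r_distr r_minus)
    moreover have "x \<ominus> y = \<zero> \<longleftrightarrow> x = y" if "x \<in> carrier R" "y \<in> carrier R" for x y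
      using that by (metis a_minus_def add.inv_closed minus_equality r_neg)
    ultimately show ?thesis using that by simp
  qed
  then show ?thesis by (auto simp: loc_rel_def)
qed

lemma (in cring) loc_rel_equiv:
  assumes "submonoid S R"
  shows "equiv (carrier R \<times> S) (loc_rel R S)"
proof -
  interpret S: submonoid S R by fact
  note iff = loc_rel_iff[OF assms]
  show ?thesis
  proof (rule equivI)
    show "loc_rel R S \<subseteq> (carrier R \<times> S) \<times> (carrier R \<times> S)"
      by (auto simp: loc_rel_def)
    show "refl_on (carrier R \<times> S) (loc_rel R S)"
      by (rule refl_onI) (auto simp: iff intro: S.one_closed)
    show "sym (loc_rel R S)"
      by (rule symI) (auto simp: iff, metis)
    show "trans (loc_rel R S)"
    proof (rule transI)
      fix x y z assume "(x, y) \<in> loc_rel R S" "(y, z) \<in> loc_rel R S"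
      then obtain a s b t c w u v where
        xyz: "x = (a, s)" "y = (b, t)" "z = (c, w)"
        and c: "a \<in> carrier R" "b \<in> carrier R" "c \<in> carrier R" "s \<in> S" "t \<in> S" "w \<in> S" "u \<in> S" "v \<in> S"
        and e1: "u \<otimes> (t \<otimes> a) = u \<otimes> (s \<otimes> b)" and e2: "v \<otimes> (w \<otimes> b) = v \<otimes> (t \<otimes> c)"
        by (cases x; cases y; cases z) (auto simp: iff)
      note c' = c(1-3) c(4-8)[THEN S.mem_carrier]
      have "(t \<otimes> u \<otimes> v) \<otimes> (w \<otimes> a) = (v \<otimes> w) \<otimes> (u \<otimes> (t \<otimes> a))"
        using c' by (simp add: m_ac)
      also have "\<dots> = (u \<otimes> s) \<otimes> (v \<otimes> (w \<otimes> b))"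
        unfolding e1 using c' by (simp add: m_ac)
      also have "\<dots> = (t \<otimes> u \<otimes> v) \<otimes> (s \<otimes> c)"
        unfolding e2 using c' by (simp add: m_ac)
      finally show "(x, z) \<in> loc_rel R S"
        using c by (auto simp: xyz iff intro!: bexI[of _ "t \<otimes> u \<otimes> v"])
    qed
  qed
qed

lemma (in cring) loc_frac_eq_iff:
  assumes "submonoid S R" "a \<in> carrier R" "s \<in> S" "b \<in> carrier R" "t \<in> S"
  shows "loc_frac R S a s = loc_frac R S b t \<longleftrightarrow> (\<exists>u\<in>S. u \<otimes> (t \<otimes> a) = u \<otimes> (s \<otimes> b))"
  unfolding loc_frac_def using assms
  by (simp add: eq_equiv_class_iff[OF loc_rel_equiv[OF assms(1)]] loc_rel_iff)

lemma localization_carrier: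
  "carrier (localization R S) = {loc_frac R S a s | a s. a \<in> carrier R \<and> s \<in> S}"
  by (auto simp: localization_def loc_frac_def quotient_def)

lemma (in cring) localization_mult:
  assumes "submonoid S R" "a \<in> carrier R" "s \<in> S" "b \<in> carrier R" "t \<in> S"
  shows "loc_frac R S a s \<otimes>\<^bsub>localization R S\<^esub> loc_frac R S b t = loc_frac R S (a \<otimes> b) (s \<otimes> t)"
proof -
  interpret S: submonoid S R by fact
  have eq: "loc_frac R S (a' \<otimes> b') (s' \<otimes> t') = loc_frac R S (a \<otimes> b) (s \<otimes> t)"
    if "(a', s') \<in> loc_frac R S a s" "(b', t') \<in> loc_frac R S b t" for a' s' b' t'
  proof -
    from that assms obtain u v where
      c: "a' \<in> carrier R" "b' \<in> carrier R" "s' \<in> S" "t' \<in> S" "u \<in> S" "v \<in> S"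
      and e1: "u \<otimes> (s' \<otimes> a) = u \<otimes> (s \<otimes> a')" and e2: "v \<otimes> (t' \<otimes> b) = v \<otimes> (t \<otimes> b')"
      by (auto simp: loc_frac_def loc_rel_iff)
    note c' = c(1,2) c(3-6)[THEN S.mem_carrier] assms(2,4) assms(3,5)[THEN S.mem_carrier]
    have "(u \<otimes> v) \<otimes> ((s \<otimes> t) \<otimes> (a' \<otimes> b')) = (u \<otimes> (s \<otimes> a')) \<otimes> (v \<otimes> (t \<otimes> b'))"
      using c' by (simp add: m_ac)
    also have "\<dots> = (u \<otimes> v) \<otimes> ((s' \<otimes> t') \<otimes> (a \<otimes> b))"
      unfolding e1[symmetric] e2[symmetric] using c' by (simp add: m_ac)
    finally show ?thesis
      using c assms by (subst loc_frac_eq_iff[OF assms(1)]) (auto intro!: bexI[of _ "u \<otimes> v"])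
  qed
  have "(a, s) \<in> loc_frac R S a s" "(b, t) \<in> loc_frac R S b t"
    using assms by (auto simp: loc_frac_def loc_rel_iff intro: S.one_closed)
  then have ne: "loc_frac R S a s \<noteq> {}" "loc_frac R S b t \<noteq> {}"
    by auto
  have "loc_frac R S a s \<otimes>\<^bsub>localization R S\<^esub> loc_frac R S b t
      = (\<Union>p\<in>loc_frac R S a s. \<Union>q\<in>loc_frac R S b t. loc_frac R S (a \<otimes> b) (s \<otimes> t))"
    unfolding localization_def split_def monoid.simps ring.simps
    by (intro SUP_cong refl eq) simp_all
  with ne show ?thesis by simp
qed

lemma (in cring) localization_add:
  assumes "submonoid S R" "a \<in> carrier R" "s \<in> S" "b \<in> carrier R" "t \<in> S"
  shows "loc_frac R S a s \<oplus>\<^bsub>localization R S\<^esub> loc_frac R S b t = loc_frac R S (t \<otimes> a \<oplus> s \<otimes> b) (s \<otimes> t)"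
proof -
  interpret S: submonoid S R by fact
  have eq: "loc_frac R S (t' \<otimes> a' \<oplus> s' \<otimes> b') (s' \<otimes> t') = loc_frac R S (t \<otimes> a \<oplus> s \<otimes> b) (s \<otimes> t)"
    if "(a', s') \<in> loc_frac R S a s" "(b', t') \<in> loc_frac R S b t" for a' s' b' t'
  proof -
    from that assms obtain u v where
      c: "a' \<in> carrier R" "b' \<in> carrier R" "s' \<in> S" "t' \<in> S" "u \<in> S" "v \<in> S"
      and e1: "u \<otimes> (s' \<otimes> a) = u \<otimes> (s \<otimes> a')" and e2: "v \<otimes> (t' \<otimes> b) = v \<otimes> (t \<otimes> b')"
      by (auto simp: loc_frac_def loc_rel_iff)
    note c' = c(1,2) c(3-6)[THEN S.mem_carrier] assms(2,4) assms(3,5)[THEN S.mem_carrier]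
    have "(u \<otimes> v) \<otimes> ((s \<otimes> t) \<otimes> (t' \<otimes> a' \<oplus> s' \<otimes> b'))
        = (v \<otimes> t \<otimes> t') \<otimes> (u \<otimes> (s \<otimes> a')) \<oplus> (u \<otimes> s \<otimes> s') \<otimes> (v \<otimes> (t \<otimes> b'))"
      using c' by (simp add: r_distr m_ac)
    also have "\<dots> = (u \<otimes> v) \<otimes> ((s' \<otimes> t') \<otimes> (t \<otimes> a \<oplus> s \<otimes> b))"
      unfolding e1[symmetric] e2[symmetric] using c' by (simp add: r_distr m_ac)
    finally show ?thesis
      using c assms by (subst loc_frac_eq_iff[OF assms(1)]) (auto intro!: bexI[of _ "u \<otimes> v"])
  qed
  have "(a, s) \<in> loc_frac R S a s" "(b, t) \<in> loc_frac R S b t"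
    using assms by (auto simp: loc_frac_def loc_rel_iff intro: S.one_closed)
  then have ne: "loc_frac R S a s \<noteq> {}" "loc_frac R S b t \<noteq> {}"
    by auto
  have "loc_frac R S a s \<oplus>\<^bsub>localization R S\<^esub> loc_frac R S b t
      = (\<Union>p\<in>loc_frac R S a s. \<Union>q\<in>loc_frac R S b t. loc_frac R S (t \<otimes> a \<oplus> s \<otimes> b) (s \<otimes> t))"
    unfolding localization_def split_def monoid.simps ring.simps
    by (intro SUP_cong refl eq) simp_all
  with ne show ?thesis by simp
qed

lemma (in cring) localization_cring:
  assumes "submonoid S R"
  shows "cring (localization R S)"
proof -
  interpret S: submonoid S R by fact
  let ?L = "localization R S"
  note ops = localization_mult[OF assms] localization_add[OF assms]
  have eqI: "loc_frac R S a s = loc_frac R S b t"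
    if "t \<otimes> a = s \<otimes> b" "a \<in> carrier R" "s \<in> S" "b \<in> carrier R" "t \<in> S" for a s b t
    using that S.one_closed by (auto simp: loc_frac_eq_iff[OF assms])
  have zero: "\<zero>\<^bsub>?L\<^esub> = loc_frac R S \<zero> \<one>" and one: "\<one>\<^bsub>?L\<^esub> = loc_frac R S \<one> \<one>"
    by (simp_all add: localization_def)
  have mem: "loc_frac R S a s \<in> carrier ?L" if "a \<in> carrier R" "s \<in> S" for a s
    using that by (auto simp: localization_carrier)
  have E: "\<exists>a s. x = loc_frac R S a s \<and> a \<in> carrier R \<and> s \<in> S" if "x \<in> carrier ?L" for x
    using that by (auto simp: localization_carrier)
  show ?thesis
  proof (rule cringI)
    show "abelian_group ?L"
    proof (rule abelian_groupI)
      fix x y z assume x: "x \<in> carrier ?L" and y: "y \<in> carrier ?L" and z: "z \<in> carrier ?L"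
      obtain a s b t c w where
        eqs: "x = loc_frac R S a s" "y = loc_frac R S b t" "z = loc_frac R S c w"
        and c: "a \<in> carrier R" "s \<in> S" "b \<in> carrier R" "t \<in> S" "c \<in> carrier R" "w \<in> S"
        using E[OF x] E[OF y] E[OF z] by metis
      show "x \<oplus>\<^bsub>?L\<^esub> y \<oplus>\<^bsub>?L\<^esub> z = x \<oplus>\<^bsub>?L\<^esub> (y \<oplus>\<^bsub>?L\<^esub> z)"
        using c by (simp add: eqs ops, intro eqI) (simp_all add: r_distr m_ac a_ac)
    next
      fix x y assume x: "x \<in> carrier ?L" and y: "y \<in> carrier ?L"
      obtain a s b t where
        eqs: "x = loc_frac R S a s" "y = loc_frac R S b t"
        and c: "a \<in> carrier R" "s \<in> S" "b \<in> carrier R" "t \<in> S"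
        using E[OF x] E[OF y] by metis
      show "x \<oplus>\<^bsub>?L\<^esub> y \<in> carrier ?L"
        using c by (simp add: eqs ops mem)
      show "x \<oplus>\<^bsub>?L\<^esub> y = y \<oplus>\<^bsub>?L\<^esub> x"
        using c by (simp add: eqs ops m_comm a_comm)
    next
      fix x assume x: "x \<in> carrier ?L"
      obtain a s where eqs: "x = loc_frac R S a s" and c: "a \<in> carrier R" "s \<in> S"
        using E[OF x] by metis
      show "\<zero>\<^bsub>?L\<^esub> \<oplus>\<^bsub>?L\<^esub> x = x"
        using c by (simp add: eqs ops zero)
      have "loc_frac R S (\<ominus> a) s \<oplus>\<^bsub>?L\<^esub> x = \<zero>\<^bsub>?L\<^esub>"
        using c by (simp add: eqs ops zero, intro eqI) (simp_all add: r_minus l_neg)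
      with c show "\<exists>y\<in>carrier ?L. y \<oplus>\<^bsub>?L\<^esub> x = \<zero>\<^bsub>?L\<^esub>"
        by (meson mem a_inv_closed)
    qed (simp add: zero mem)
    show "comm_monoid ?L"
    proof (rule comm_monoidI)
      fix x y z assume x: "x \<in> carrier ?L" and y: "y \<in> carrier ?L" and z: "z \<in> carrier ?L"
      obtain a s b t c w where
        eqs: "x = loc_frac R S a s" "y = loc_frac R S b t" "z = loc_frac R S c w"
        and c: "a \<in> carrier R" "s \<in> S" "b \<in> carrier R" "t \<in> S" "c \<in> carrier R" "w \<in> S"
        using E[OF x] E[OF y] E[OF z] by metis
      show "x \<otimes>\<^bsub>?L\<^esub> y \<otimes>\<^bsub>?L\<^esub> z = x \<otimes>\<^bsub>?L\<^esub> (y \<otimes>\<^bsub>?L\<^esub> z)"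
        using c by (simp add: eqs ops m_assoc)
    next
      fix x y assume x: "x \<in> carrier ?L" and y: "y \<in> carrier ?L"
      obtain a s b t where
        eqs: "x = loc_frac R S a s" "y = loc_frac R S b t"
        and c: "a \<in> carrier R" "s \<in> S" "b \<in> carrier R" "t \<in> S"
        using E[OF x] E[OF y] by metis
      show "x \<otimes>\<^bsub>?L\<^esub> y \<in> carrier ?L"
        using c by (simp add: eqs ops mem)
      show "x \<otimes>\<^bsub>?L\<^esub> y = y \<otimes>\<^bsub>?L\<^esub> x"
        using c by (simp add: eqs ops m_comm)
    next
      fix x assume x: "x \<in> carrier ?L"
      obtain a s where eqs: "x = loc_frac R S a s" and c: "a \<in> carrier R" "s \<in> S"
        using E[OF x] by metis
      show "\<one>\<^bsub>?L\<^esub> \<otimes>\<^bsub>?L\<^esub> x = x"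
        using c by (simp add: eqs ops one)
    qed (simp add: one mem)
  next
    fix x y z assume x: "x \<in> carrier ?L" and y: "y \<in> carrier ?L" and z: "z \<in> carrier ?L"
    obtain a s b t c w where
      eqs: "x = loc_frac R S a s" "y = loc_frac R S b t" "z = loc_frac R S c w"
      and c: "a \<in> carrier R" "s \<in> S" "b \<in> carrier R" "t \<in> S" "c \<in> carrier R" "w \<in> S"
      using E[OF x] E[OF y] E[OF z] by metis
    show "(x \<oplus>\<^bsub>?L\<^esub> y) \<otimes>\<^bsub>?L\<^esub> z = x \<otimes>\<^bsub>?L\<^esub> z \<oplus>\<^bsub>?L\<^esub> y \<otimes>\<^bsub>?L\<^esub> z"
      using c by (simp add: eqs ops, intro eqI) (simp_all add: r_distr l_distr m_ac)
  qed
qed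

lemma (in cring) free_module_module: "module R (free_module R n)"
proof (rule moduleI)
  show "abelian_group (free_module R n)"
  proof (rule abelian_groupI)
    fix x assume "x \<in> carrier (free_module R n)"
    then show "\<exists>y\<in>carrier (free_module R n). y \<oplus>\<^bsub>free_module R n\<^esub> x = \<zero>\<^bsub>free_module R n\<^esub>"
      by (intro bexI[of _ "\<lambda>i\<in>{..<n}. \<ominus> x i"])
         (auto simp: free_module_def PiE_iff l_neg intro!: restrict_ext)
  qed (auto simp: free_module_def PiE_iff a_ac extensional_def)
qed (auto simp: free_module_def PiE_iff l_distr r_distr m_assoc extensional_def is_cring)

lemma (in cring) ideal_module_module:
  assumes "ideal J R"
  shows "module R (ideal_module R J)"
proof -
  interpret J: ideal J R by fact
  show ?thesis
  proof (rule moduleI)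
    show "abelian_group (ideal_module R J)"
    proof (rule abelian_groupI)
      fix x assume "x \<in> carrier (ideal_module R J)"
      then show "\<exists>y\<in>carrier (ideal_module R J). y \<oplus>\<^bsub>ideal_module R J\<^esub> x = \<zero>\<^bsub>ideal_module R J\<^esub>"
        by (intro bexI[of _ "\<ominus> x"]) (auto simp: ideal_module_def J.Icarr l_neg)
    qed (auto simp: ideal_module_def J.Icarr a_ac)
  qed (auto simp: ideal_module_def J.Icarr J.I_l_closed l_distr r_distr m_assoc is_cring)
qed

end

theory Submission
  imports Defs
begin

text \<open>
  The localization is regular by a direct computation: if \<open>s a = r a\<^sup>2\<close>, then \<open>r t / s\<close> is a
  quasi-inverse of \<open>a / t\<close>, where the uniform \<open>s\<close> serves all numerators \<open>a\<close> at once.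

  Coherence does not follow by clearing denominators in the localization: regularity up to \<open>s\<close>
  turns a finitely generated ideal into one generated by some \<open>g\<close> with \<open>g\<^sup>2 = t g\<close>, \<open>t \<in> S\<close>, but the
  annihilator of such a \<open>g\<close> agrees with the ideal of \<open>t - g\<close> only up to multiplication by \<open>t\<close>, and
  so it need not be finitely generated. What helps is to apply the hypothesis to a power of \<open>s\<close>
  itself: \<open>a = s\<^sup>2\<close> gives \<open>s\<^sup>3 = r s\<^sup>4\<close>, so the powers of \<open>s\<close> become stationary up to associates, and
  \<open>s\<^sup>3\<close> generates the same ideal as an idempotent \<open>e\<close> (lemma \<open>uniform_denominator_idempotent\<close>).
  The ring thus splits as \<open>e R \<times> (1 - e) R\<close>, where \<open>s\<close> is invertible in the first factor and
  nilpotent in the second. The first factor is an honest von Neumann regular ring, in which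
  finitely generated ideals are generated by idempotents
  (lemma \<open>idempotent_absorbing_finite_set\<close>), while multiplication by \<open>s\<^sup>3\<close> kills the second.
  Hence for a finitely generated ideal \<open>J\<close> there is an idempotent \<open>f\<close> with \<open>s\<^sup>3 J \<subseteq> f R \<subseteq> J\<close>. Finally
  \<open>f R\<close> is finitely presented because the annihilator of \<open>f\<close> is generated by \<open>1 - f\<close>
  (lemma \<open>fin_presented_idempotent\<close>).
\<close>

section \<open>Regularity of the localization\<close>

lemma (in cring) localization_von_neumann_regular:
  assumes S: "submonoid S R" and u: "u_S_von_neumann_regular R S"
  shows "von_neumann_regular (localization R S)"
proof -
  interpret S: submonoid S R by fact
  let ?L = "localization R S"
  interpret L: cring ?L by (rule localization_cring[OF S])
  obtain s where s: "s \<in> S"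
    and reg: "\<And>a. a \<in> carrier R \<Longrightarrow> \<exists>r\<in>carrier R. s \<otimes> a = r \<otimes> a [^] (2::nat)"
    using u unfolding u_S_von_neumann_regular_def by blast
  show ?thesis
  proof (intro von_neumann_regular.intro von_neumann_regular_axioms.intro)
    show "cring ?L" by (rule L.is_cring)
    fix x assume "x \<in> carrier ?L"
    then obtain a t where x: "x = loc_frac R S a t" and a: "a \<in> carrier R" and t: "t \<in> S"
      by (auto simp: localization_carrier)
    obtain r where r: "r \<in> carrier R" and eq: "s \<otimes> a = r \<otimes> a [^] (2::nat)"
      using reg[OF a] by blast
    note c = a r s[THEN S.mem_carrier] t[THEN S.mem_carrier]
    have eq': "s \<otimes> a = r \<otimes> (a \<otimes> a)"
      using eq a by (simp add: numeral_2_eq_2)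
    have "x [^]\<^bsub>?L\<^esub> (2::nat) = x \<otimes>\<^bsub>?L\<^esub> x"
      using \<open>x \<in> carrier ?L\<close> by (simp add: numeral_2_eq_2)
    then have "loc_frac R S (r \<otimes> t) s \<otimes>\<^bsub>?L\<^esub> x [^]\<^bsub>?L\<^esub> (2::nat)
        = loc_frac R S ((r \<otimes> t) \<otimes> (a \<otimes> a)) (s \<otimes> (t \<otimes> t))"
      using c s t by (simp add: x localization_mult[OF S])
    also have "\<dots> = x"
    proof -
      have "t \<otimes> ((r \<otimes> t) \<otimes> (a \<otimes> a)) = (t \<otimes> t) \<otimes> (r \<otimes> (a \<otimes> a))"
        using c by (simp add: m_ac)
      also have "\<dots> = (s \<otimes> (t \<otimes> t)) \<otimes> a"
        unfolding eq'[symmetric] using c by (simp add: m_ac)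
      finally show ?thesis
        using c s t S.one_closed by (auto simp: x loc_frac_eq_iff[OF S])
    qed
    finally show "\<exists>y\<in>carrier ?L. x = y \<otimes>\<^bsub>?L\<^esub> x [^]\<^bsub>?L\<^esub> (2::nat)"
      using c s by (intro bexI[of _ "loc_frac R S (r \<otimes> t) s"]) (auto simp: localization_carrier)
  qed
qed

section \<open>Idempotent generators up to a uniform denominator\<close>

text \<open>
  Iterating \<open>s\<^sup>3 = r s\<^sup>4\<close> gives \<open>s\<^sup>3 = r\<^sup>3 s\<^sup>6\<close>, which says that \<open>s\<^sup>3\<close> is von Neumann regular with
  quasi-inverse \<open>q = r\<^sup>3\<close>; the product of the two is the idempotent.
\<close>

lemma (in cring) uniform_denominator_idempotent:
  assumes s: "s \<in> carrier R" and r: "r \<in> carrier R"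
    and eq: "s \<otimes> (s \<otimes> s) = r \<otimes> ((s \<otimes> s) \<otimes> (s \<otimes> s))"
  obtains e q where "q \<in> carrier R" "e = q \<otimes> (s \<otimes> (s \<otimes> s))" "e \<otimes> e = e"
    "e \<otimes> (s \<otimes> (s \<otimes> s)) = s \<otimes> (s \<otimes> s)"
proof -
  define z where "z = s \<otimes> (s \<otimes> s)"
  define q where "q = r \<otimes> (r \<otimes> r)"
  have z: "z \<in> carrier R" and q: "q \<in> carrier R"
    using s r by (simp_all add: z_def q_def)
  have step: "r \<otimes> s \<otimes> z = z"
    using eq s r by (simp add: z_def m_ac)
  have "q \<otimes> z \<otimes> z = r \<otimes> s \<otimes> (r \<otimes> s \<otimes> (r \<otimes> s \<otimes> z))"
    using s r z unfolding q_def by (subst (1) z_def) (simp add: m_ac)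
  then have qzz: "q \<otimes> z \<otimes> z = z"
    by (simp add: step)
  have "(q \<otimes> z) \<otimes> (q \<otimes> z) = q \<otimes> (q \<otimes> z \<otimes> z)"
    using q z by (simp add: m_ac)
  with qzz that[of q "q \<otimes> z"] q show thesis
    by (simp add: z_def)
qed

text \<open>
  In \<open>e R\<close> every element \<open>e a\<close> has a quasi-inverse \<open>p\<close> and hence generates the same ideal as the
  idempotent \<open>p e a\<close>; two idempotents \<open>f\<close>, \<open>g\<close> generate the same ideal as their join
  \<open>f + g - f g\<close>. Fixing the ambient ideal \<open>J\<close> lets the induction run over the generating set.
\<close>

lemma (in cring) idempotent_absorbing_finite_set:
  assumes e: "e \<in> carrier R" "e \<otimes> e = e"
    and reg: "\<And>a. a \<in> carrier R \<Longrightarrow> \<exists>p\<in>carrier R. e \<otimes> a = p \<otimes> (a \<otimes> a)"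
    and J: "ideal J R" and A: "finite A" "A \<subseteq> J"
  shows "\<exists>f\<in>J. f \<otimes> f = f \<and> (\<forall>a\<in>A. f \<otimes> (e \<otimes> a) = e \<otimes> a)"
  using A
proof (induction A rule: finite_induct)
  interpret J: ideal J R by fact
  case empty
  then show ?case by (intro bexI[of _ \<zero>]) auto
next
  interpret J: ideal J R by fact
  case (insert a A)
  then obtain f where fJ: "f \<in> J" and ff: "f \<otimes> f = f"
    and fA: "\<And>b. b \<in> A \<Longrightarrow> f \<otimes> (e \<otimes> b) = e \<otimes> b"
    by auto
  have aJ: "a \<in> J" and AJ: "A \<subseteq> J" using insert.prems by auto
  then have a: "a \<in> carrier R" by (simp add: J.Icarr)
  have f: "f \<in> carrier R" using fJ by (simp add: J.Icarr)
  obtain p where p: "p \<in> carrier R" and pa: "e \<otimes> a = p \<otimes> (a \<otimes> a)"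
    using reg[OF a] by blast
  define g where "g = p \<otimes> (e \<otimes> a)"
  have gJ: "g \<in> J" using p e aJ by (simp add: g_def J.I_l_closed)
  then have g: "g \<in> carrier R" by (simp add: J.Icarr)
  have "g \<otimes> a = e \<otimes> (p \<otimes> (a \<otimes> a))"
    using p e a by (simp add: g_def m_ac)
  also have "\<dots> = (e \<otimes> e) \<otimes> a"
    unfolding pa[symmetric] using e(1) a by (simp add: m_assoc)
  finally have ga: "g \<otimes> a = e \<otimes> a" by (simp add: e(2))
  have "g \<otimes> (e \<otimes> a) = e \<otimes> (g \<otimes> a)"
    using g e(1) a by (simp add: m_ac)
  also have "\<dots> = (e \<otimes> e) \<otimes> a"
    unfolding ga using e(1) a by (simp add: m_assoc)
  finally have gea: "g \<otimes> (e \<otimes> a) = e \<otimes> a" by (simp add: e(2))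
  have "g \<otimes> g = p \<otimes> (g \<otimes> (e \<otimes> a))"
    using p e(1) a g by (subst (2) g_def) (simp add: m_ac)
  also have "\<dots> = g" unfolding gea by (simp add: g_def)
  finally have gg: "g \<otimes> g = g" .
  define h where "h = f \<oplus> g \<ominus> f \<otimes> g"
  have hJ: "h \<in> J"
    unfolding h_def a_minus_def using fJ gJ f by (simp add: J.I_l_closed)
  then have h: "h \<in> carrier R" by (simp add: J.Icarr)
  have absorb_f: "h \<otimes> x = x" if x: "x \<in> carrier R" "f \<otimes> x = x" for x
  proof -
    have "h \<otimes> x = f \<otimes> x \<oplus> g \<otimes> x \<ominus> g \<otimes> (f \<otimes> x)"
      unfolding h_def using f g x(1) by algebra
    also have "\<dots> = x" unfolding x(2) using g x(1) by algebra
    finally show ?thesis .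
  qed
  have absorb_g: "h \<otimes> x = x" if x: "x \<in> carrier R" "g \<otimes> x = x" for x
  proof -
    have "h \<otimes> x = f \<otimes> x \<oplus> g \<otimes> x \<ominus> f \<otimes> (g \<otimes> x)"
      unfolding h_def using f g x(1) by algebra
    also have "\<dots> = x" unfolding x(2) using f x(1) by algebra
    finally show ?thesis .
  qed
  have "h \<otimes> h = h \<otimes> f \<oplus> h \<otimes> g \<ominus> (h \<otimes> f) \<otimes> g"
    using h f g by (subst (2) h_def) algebra
  also have "\<dots> = h"
    unfolding absorb_f[OF f ff] absorb_g[OF g gg] by (simp add: h_def)
  finally have "h \<otimes> h = h" .
  moreover have "h \<otimes> (e \<otimes> b) = e \<otimes> b" if "b \<in> insert a A" for b
    using that absorb_f absorb_g gea fA AJ a e(1) by (auto simp: J.Icarr subset_iff)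
  ultimately show ?case using hJ by blast
qed

text \<open>
  The absorbed elements form an ideal, so it suffices to absorb a finite generating set.
\<close>

lemma (in cring) idempotent_absorbing_fin_gen_ideal:
  assumes e: "e \<in> carrier R" "e \<otimes> e = e"
    and reg: "\<And>a. a \<in> carrier R \<Longrightarrow> \<exists>p\<in>carrier R. e \<otimes> a = p \<otimes> (a \<otimes> a)"
    and J: "fin_gen_ideal R J"
  obtains f where "f \<in> J" "f \<otimes> f = f" "\<And>x. x \<in> J \<Longrightarrow> f \<otimes> (e \<otimes> x) = e \<otimes> x"
proof -
  obtain A where A: "finite A" "A \<subseteq> carrier R" "J = Idl A"
    using J unfolding fin_gen_ideal_def by blast
  have idl: "ideal J R" and AJ: "A \<subseteq> J"
    using A by (simp_all add: genideal_ideal genideal_self)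
  obtain f where f: "f \<in> J" "f \<otimes> f = f" and fA: "\<forall>a\<in>A. f \<otimes> (e \<otimes> a) = e \<otimes> a"
    using idempotent_absorbing_finite_set[OF e reg idl A(1) AJ] by blast
  have fc: "f \<in> carrier R" using ideal.Icarr[OF idl f(1)] .
  let ?K = "{x \<in> carrier R. f \<otimes> (e \<otimes> x) = e \<otimes> x}"
  have "ideal ?K R"
  proof (rule idealI)
    show "ring R" by (rule ring_axioms)
    show "subgroup ?K (add_monoid R)"
    proof (rule add.subgroupI)
      show "?K \<noteq> {}" using fc e by (auto intro: exI[of _ \<zero>])
    next
      fix x assume "x \<in> ?K"
      then show "\<ominus> x \<in> ?K" using fc e(1) by (simp add: r_minus)
    next
      fix x y assume "x \<in> ?K" "y \<in> ?K"
      then show "x \<oplus> y \<in> ?K" using fc e(1) by (simp add: r_distr)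
    qed auto
  next
    fix x y assume xy: "x \<in> ?K" "y \<in> carrier R"
    then have x: "x \<in> carrier R" by simp
    have "f \<otimes> (e \<otimes> (y \<otimes> x)) = y \<otimes> (f \<otimes> (e \<otimes> x))"
      using fc e(1) x xy(2) by (simp add: m_ac)
    also have "\<dots> = y \<otimes> (e \<otimes> x)"
      using xy by simp
    also have "\<dots> = e \<otimes> (y \<otimes> x)"
      using x xy(2) e(1) by (simp add: m_lcomm)
    finally show "y \<otimes> x \<in> ?K"
      using xy by simp
    then show "x \<otimes> y \<in> ?K"
      using xy by (simp add: m_comm[of x y])
  qed
  then have "J \<subseteq> ?K"
    unfolding A(3) by (rule genideal_minimal) (use A fA in auto)
  with that[OF f] show thesis by auto
qed

section \<open>Finite presentation and coherence\<close>

text \<open>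
  Multiplication by \<open>f\<close> maps \<open>R\<close> onto \<open>f R\<close>, and its kernel is generated by \<open>1 - f\<close>: if \<open>x f = 0\<close>,
  then \<open>x = x (1 - f)\<close>.
\<close>

lemma (in cring) fin_presented_idempotent:
  assumes f: "f \<in> carrier R" "f \<otimes> f = f"
  shows "fin_presented R (ideal_module R (PIdl f))"
proof -
  let ?F = "free_module R (Suc 0)" and ?J = "ideal_module R (PIdl f)"
  interpret F: module R ?F by (rule free_module_module)
  define \<phi> where "\<phi> x = x 0 \<otimes> f" for x :: "nat \<Rightarrow> 'a"
  define k where "k = (\<lambda>i\<in>{..<Suc 0}. \<one> \<ominus> f)"
  have F0: "x 0 \<in> carrier R" if "x \<in> carrier ?F" for x
    using that by (auto simp: free_module_def PiE_iff)
  have Fconst: "(\<lambda>i\<in>{..<Suc 0}. c) \<in> carrier ?F" if "c \<in> carrier R" for c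
    using that by (auto simp: free_module_def)
  have kF: "k \<in> carrier ?F"
    unfolding k_def using f by (intro Fconst) simp
  have hom: "\<phi> \<in> module_hom R ?F ?J"
    using f F0 unfolding module_hom_def hom_def
    by (auto simp: \<phi>_def ideal_module_def cgenideal_def free_module_def PiE_iff l_distr m_assoc)
  have surj: "\<phi> ` carrier ?F = carrier ?J"
  proof (intro equalityI subsetI)
    fix y assume "y \<in> carrier ?J"
    then obtain c where c: "c \<in> carrier R" "y = c \<otimes> f"
      by (auto simp: ideal_module_def cgenideal_def)
    then have "y = \<phi> (\<lambda>i\<in>{..<Suc 0}. c)" by (simp add: \<phi>_def)
    then show "y \<in> \<phi> ` carrier ?F" using Fconst[OF c(1)] by blast
  qed (auto simp: \<phi>_def ideal_module_def cgenideal_def F0)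
  have ker: "a_kernel ?F ?J \<phi> = {x \<in> carrier ?F. x 0 \<otimes> f = \<zero>}"
    by (auto simp: a_kernel_def kernel_def \<phi>_def ideal_module_def)
  have ann: "(\<one> \<ominus> f) \<otimes> f = \<zero>"
  proof -
    have "(\<one> \<ominus> f) \<otimes> f = f \<ominus> f \<otimes> f" using f(1) by algebra
    also have "\<dots> = \<zero>" unfolding f(2) using f(1) by algebra
    finally show ?thesis .
  qed
  have "submodule (a_kernel ?F ?J \<phi>) R ?F"
  proof (rule F.submoduleI)
    fix x assume "x \<in> a_kernel ?F ?J \<phi>"
    then have x: "x \<in> carrier ?F" "x 0 \<otimes> f = \<zero>" by (simp_all add: ker)
    \<comment> \<open>The additive inverse of a module is not given by a formula; as a scalar multiple it can be
      evaluated at a coordinate.\<close>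
    have "(\<ominus>\<^bsub>?F\<^esub> x) = (\<ominus> \<one>) \<odot>\<^bsub>?F\<^esub> x"
      using x by (simp add: F.smult_l_minus)
    then have "(\<ominus>\<^bsub>?F\<^esub> x) 0 = \<ominus> (x 0)"
      using F0[OF x(1)] by (simp add: free_module_def l_minus)
    then show "\<ominus>\<^bsub>?F\<^esub> x \<in> a_kernel ?F ?J \<phi>"
      using x f F0 by (simp add: ker l_minus)
  next
    fix x y assume "x \<in> a_kernel ?F ?J \<phi>" "y \<in> a_kernel ?F ?J \<phi>"
    then have xy: "x \<in> carrier ?F" "y \<in> carrier ?F" "x 0 \<otimes> f = \<zero>" "y 0 \<otimes> f = \<zero>"
      by (simp_all add: ker)
    have "(x \<oplus>\<^bsub>?F\<^esub> y) 0 = x 0 \<oplus> y 0" by (simp add: free_module_def)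
    with xy f show "x \<oplus>\<^bsub>?F\<^esub> y \<in> a_kernel ?F ?J \<phi>"
      by (simp add: ker l_distr F0)
  next
    fix c x assume c: "c \<in> carrier R" and "x \<in> a_kernel ?F ?J \<phi>"
    then have x: "x \<in> carrier ?F" "x 0 \<otimes> f = \<zero>" by (simp_all add: ker)
    have "(c \<odot>\<^bsub>?F\<^esub> x) 0 = c \<otimes> x 0" by (simp add: free_module_def)
    with c x f show "c \<odot>\<^bsub>?F\<^esub> x \<in> a_kernel ?F ?J \<phi>"
      by (simp add: ker m_assoc F0)
  next
    have "\<zero>\<^bsub>?F\<^esub> 0 = \<zero>" by (simp add: free_module_def)
    then show "\<zero>\<^bsub>?F\<^esub> \<in> a_kernel ?F ?J \<phi>" using f by (simp add: ker)
  qed (auto simp: ker)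
  moreover have "k \<in> a_kernel ?F ?J \<phi>"
    using kF ann by (simp add: ker k_def)
  moreover have "a_kernel ?F ?J \<phi> \<subseteq> N" if N: "submodule N R ?F" "k \<in> N" for N
  proof
    fix x assume "x \<in> a_kernel ?F ?J \<phi>"
    then have x: "x \<in> carrier ?F" "x 0 \<otimes> f = \<zero>" by (simp_all add: ker)
    have "x 0 \<otimes> (\<one> \<ominus> f) = x 0 \<ominus> x 0 \<otimes> f"
      using F0[OF x(1)] f(1) by algebra
    also have "\<dots> = x 0" unfolding x(2) using F0[OF x(1)] by algebra
    finally have "x = x 0 \<odot>\<^bsub>?F\<^esub> k"
      using x by (auto simp: free_module_def k_def fun_eq_iff PiE_iff extensional_def)
    then show "x \<in> N"
      using submodule.smult_closed[OF N(1) F0[OF x(1)] N(2)] by simp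
  qed
  ultimately have "a_kernel ?F ?J \<phi> = gen_submodule R ?F {k}"
    unfolding gen_submodule_def by blast
  then have "fin_gen_submodule R ?F (a_kernel ?F ?J \<phi>)"
    unfolding fin_gen_submodule_def using kF by (intro exI[of _ "{k}"]) simp
  with hom surj show ?thesis
    unfolding fin_presented_def
    using ideal_module_module[OF cgenideal_ideal[OF f(1)]] by blast
qed

text \<open>
  The denominator \<open>t\<close> moves \<open>I\<close> into a finitely generated ideal \<open>J\<close>, and \<open>z = s\<^sup>3\<close> moves \<open>J\<close> into the
  ideal of the idempotent \<open>f\<close>: for \<open>w\<close> in \<open>J\<close>, \<open>z w = z (e w)\<close> is a multiple of \<open>f\<close> because \<open>f\<close> absorbs
  \<open>e w\<close>. As \<open>f\<close> lies in \<open>J\<close>, its ideal stays inside \<open>I\<close>.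
\<close>

lemma (in cring) u_S_von_neumann_regular_imp_c_S_coherent:
  assumes S: "submonoid S R" and u: "u_S_von_neumann_regular R S"
  shows "c_S_coherent R S"
  unfolding c_S_coherent_def
proof (intro allI impI)
  interpret S: submonoid S R by fact
  fix I assume I: "ideal I R" and "S_finite R S I"
  then obtain t J where t: "t \<in> S" and J: "fin_gen_ideal R J" "J \<subseteq> I"
    and tI: "t <# I \<subseteq> J"
    unfolding S_finite_def by blast
  have Jid: "ideal J R"
    using J(1) unfolding fin_gen_ideal_def by (auto simp: genideal_ideal)
  obtain s where sS: "s \<in> S"
    and reg: "\<And>a. a \<in> carrier R \<Longrightarrow> \<exists>r\<in>carrier R. s \<otimes> a = r \<otimes> a [^] (2::nat)"
    using u unfolding u_S_von_neumann_regular_def by blast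
  have s: "s \<in> carrier R" using sS by (rule S.mem_carrier)
  have sreg: "\<exists>r\<in>carrier R. s \<otimes> a = r \<otimes> (a \<otimes> a)" if "a \<in> carrier R" for a
    using reg[OF that] that by (simp add: numeral_2_eq_2)
  define z where "z = s \<otimes> (s \<otimes> s)"
  have zS: "z \<in> S" using sS by (simp add: z_def)
  then have z: "z \<in> carrier R" by (rule S.mem_carrier)
  obtain r where "r \<in> carrier R" "s \<otimes> (s \<otimes> s) = r \<otimes> ((s \<otimes> s) \<otimes> (s \<otimes> s))"
    using sreg[of "s \<otimes> s"] s by auto
  from uniform_denominator_idempotent[OF s this] obtain e q where q: "q \<in> carrier R"
    and eq: "e = q \<otimes> z" and ee: "e \<otimes> e = e" and ez: "e \<otimes> z = z"
    unfolding z_def by blast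
  have e: "e \<in> carrier R" using q z by (simp add: eq)
  have ereg: "\<exists>p\<in>carrier R. e \<otimes> a = p \<otimes> (a \<otimes> a)" if a: "a \<in> carrier R" for a
  proof -
    obtain p where p: "p \<in> carrier R" "s \<otimes> a = p \<otimes> (a \<otimes> a)" using sreg[OF a] by blast
    have "e \<otimes> a = (q \<otimes> (s \<otimes> s)) \<otimes> (s \<otimes> a)"
      unfolding eq z_def using q s a by (simp add: m_ac)
    also have "\<dots> = (q \<otimes> (s \<otimes> s) \<otimes> p) \<otimes> (a \<otimes> a)"
      unfolding p(2) using q s a p(1) by (simp add: m_assoc)
    finally show ?thesis using q s p(1) by blast
  qed
  obtain f where fJ: "f \<in> J" and ff: "f \<otimes> f = f"
    and absorb: "\<And>x. x \<in> J \<Longrightarrow> f \<otimes> (e \<otimes> x) = e \<otimes> x"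
    using idempotent_absorbing_fin_gen_ideal[OF e ee ereg J(1)] by blast
  have f: "f \<in> carrier R" using ideal.Icarr[OF Jid fJ] .
  have "(z \<otimes> t) <# I \<subseteq> PIdl f"
  proof
    fix y assume "y \<in> (z \<otimes> t) <# I"
    then obtain x where x: "x \<in> I" "y = (z \<otimes> t) \<otimes> x" by (auto simp: l_coset_def)
    define w where "w = t \<otimes> x"
    have wJ: "w \<in> J" using tI x(1) by (auto simp: l_coset_def w_def)
    then have w: "w \<in> carrier R" by (rule ideal.Icarr[OF Jid])
    have "y = (e \<otimes> z) \<otimes> w"
      using x ideal.Icarr[OF I x(1)] z S.mem_carrier[OF t] by (simp add: ez w_def m_assoc)
    also have "\<dots> = z \<otimes> (e \<otimes> w)" using e z w by (simp add: m_ac)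
    also have "\<dots> = (z \<otimes> (e \<otimes> w)) \<otimes> f"
      using absorb[OF wJ] e z w f by (metis m_assoc m_comm m_closed)
    finally show "y \<in> PIdl f"
      using e z w by (auto simp: cgenideal_def)
  qed
  moreover have "PIdl f \<subseteq> I"
    using cgenideal_minimal[OF Jid fJ] J(2) by blast
  ultimately show "c_S_fin_presented R S I"
    unfolding c_S_fin_presented_def
    using zS t cgenideal_ideal[OF f] fin_presented_idempotent[OF f ff] S.m_closed by blast
qed

theorem corollary3p14:
  fixes R :: "('a, 'b) ring_scheme" and S :: "'a set"
  assumes "cring R"
    and "submonoid S R"
    and "u_S_von_neumann_regular R S"
  shows "von_neumann_regular (localization R S) \<and> c_S_coherent R S"
  using cring.localization_von_neumann_regular[OF assms]
    cring.u_S_von_neumann_regular_imp_c_S_coherent[OF assms]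
  by blast

end
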